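(* The complete bipartite graph $K_{2,3}$ is not the (slide) $\gamma$-graph of any bipartite graph. That is, there is no bipartite graph $G$ such that the graph $\mathcal{S}(G,\gamma)$ is isomorphic to $K_{2,3}$.
   Context: Graphs are finite, simple and undirected (and $G$ is not assumed connected). For a graph $G$ and a vertex $v$, $N(v)$ is the set of vertices adjacent to $v$ and $N[v]=N(v)\cup\{v\}$; for a set $S$ of vertices, $N[S]=\bigcup_{x\in S}N[x]$. A set $D\subseteq V(G)$ is a dominating set of $G$ if $N[D]=V(G)$. The domination number $\gamma(G)$ is the minimum cardinality of a dominating set of $G$, and a $\gamma$-set of $G$ is a dominating set of cardinality $\gamma(G)$. The slide $\gamma$-graph $\mathcal{S}(G,\gamma)$ (also denoted $G(\gamma)$, and called simply the $\gamma$-graph of $G$) is the graph whose vertices are the $\gamma$-sets of $G$, where two $\gamma$-sets $D_1$ and $D_2$ are adjacent if and only if there exist vertices $x\in D_1$ and $y\in D_2$ that are adjacent in $G$ and satisfy $D_1\setminus\{x\}=D_2\setminus\{y\}$. $K_{2,3}$ denotes the complete bipartite graph with parts of sizes $2$ and $3$. *)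

theory Defs
  imports "Graph_Theory.Graph_Theory"
begin

(* A finite simple undirected graph is a term satisfying the locale predicate graph:
   finite, loop-free, no parallel arcs, symmetric. The two orientations of an edge are both
   present, so adjacency of u and v is (u, v) \<in> arcs_ends G, written u \<rightarrow>\<^bsub>G\<^esub> v. *)

definition bipartite :: "('a, 'b) pre_digraph \<Rightarrow> bool" where
  "bipartite G \<longleftrightarrow> (\<exists>U V. verts G = U \<union> V \<and> U \<inter> V = {} \<and> arcs_ends G \<subseteq> U \<times> V \<union> V \<times> U)"

definition neighborhood :: "('a, 'b) pre_digraph \<Rightarrow> 'a \<Rightarrow> 'a set" where
  "neighborhood G v = {u. v \<rightarrow>\<^bsub>G\<^esub> u}"

definition closed_neighborhood :: "('a, 'b) pre_digraph \<Rightarrow> 'a \<Rightarrow> 'a set" where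
  "closed_neighborhood G v = insert v (neighborhood G v)"

definition dominating_set :: "('a, 'b) pre_digraph \<Rightarrow> 'a set \<Rightarrow> bool" where
  "dominating_set G D \<longleftrightarrow> D \<subseteq> verts G \<and> (\<Union>x\<in>D. closed_neighborhood G x) = verts G"

definition domination_number :: "('a, 'b) pre_digraph \<Rightarrow> nat" where
  "domination_number G = (LEAST n. \<exists>D. dominating_set G D \<and> card D = n)"

definition gamma_set :: "('a, 'b) pre_digraph \<Rightarrow> 'a set \<Rightarrow> bool" where
  "gamma_set G D \<longleftrightarrow> dominating_set G D \<and> card D = domination_number G"

definition slide_gamma_graph :: "('a, 'b) pre_digraph \<Rightarrow> 'a set pair_pre_digraph" where
  "slide_gamma_graph G =
    \<lparr> pverts = {D. gamma_set G D},
      parcs = {(D1, D2). gamma_set G D1 \<and> gamma_set G D2 \<and>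
        (\<exists>x\<in>D1. \<exists>y\<in>D2. x \<rightarrow>\<^bsub>G\<^esub> y \<and> D1 - {x} = D2 - {y})} \<rparr>"

end

theory Submission
  imports Defs
begin

text \<open>
  Only the absence of triangles in \<open>G\<close> matters: if \<open>u\<close> and \<open>v\<close> are adjacent, then
  \<open>N[u] \<inter> N[v] = {u, v}\<close>. Suppose that the \<open>\<gamma>\<close>-sets are two sets \<open>A\<close>, \<open>B\<close> and three common
  neighbours of them, and let \<open>S = A \<inter> B\<close>.

  If \<open>A = S \<union> {a}\<close> and \<open>B = S \<union> {b}\<close>, a common neighbour is either \<open>S \<union> {c}\<close> or
  \<open>(S - {s}) \<union> {a, b}\<close>. In the first case \<open>c\<close> is the only vertex not dominated by \<open>S\<close>, so there is
  at most one such set. Two distinct sets of the second kind, given by \<open>s\<close> and \<open>t\<close>, would make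
  \<open>(S - {s}) \<union> {a}\<close> dominating, although it is too small.

  Otherwise \<open>A = S \<union> {a, a'}\<close> and \<open>B = S \<union> {b, b'}\<close>, and the common neighbours are among the four
  sets \<open>S \<union> {p, q}\<close> with \<open>p \<in> {a, a'}\<close>, \<open>q \<in> {b, b'}\<close>. If three of these are \<open>\<gamma>\<close>-sets, then so is the
  fourth, which gives a sixth \<open>\<gamma>\<close>-set.
\<close>

section \<open>Domination, \<gamma>-sets and slides\<close>

lemma closed_neighborhood_iff: "v \<in> closed_neighborhood G u \<longleftrightarrow> v = u \<or> u \<rightarrow>\<^bsub>G\<^esub> v"
  by (auto simp: closed_neighborhood_def neighborhood_def)

context graph
begin

lemma dominating_set_iff:
  "dominating_set G D \<longleftrightarrow>
    D \<subseteq> verts G \<and> (\<forall>v\<in>verts G. \<exists>x\<in>D. v \<in> closed_neighborhood G x)"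
  using adj_in_verts unfolding dominating_set_def
  by (fastforce simp: closed_neighborhood_iff)

lemma gamma_set_finite: "gamma_set G D \<Longrightarrow> finite D"
  unfolding gamma_set_def dominating_set_def using finite_verts finite_subset by blast

lemma gamma_set_card_eq: "gamma_set G D \<Longrightarrow> gamma_set G D' \<Longrightarrow> card D = card D'"
  by (simp add: gamma_set_def)

lemma gamma_set_card_le:
  assumes "gamma_set G D" "dominating_set G D'"
  shows "card D \<le> card D'"
  using assms unfolding gamma_set_def domination_number_def by (metis (mono_tags, lifting) Least_le)

lemma gamma_setI:
  assumes "gamma_set G D" "dominating_set G D'" "card D' = card D"
  shows "gamma_set G D'"
  using assms by (simp add: gamma_set_def)

text \<open>Adjacency is irreflexive, so the arriving vertex \<open>y\<close> lies outside
  \<open>D\<close>: a slide is a genuine exchange.\<close>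

lemma slideE:
  assumes "(D, D') \<in> parcs (slide_gamma_graph G)"
  obtains x y where "x \<in> D" "y \<notin> D" "x \<rightarrow> y" "D' = insert y (D - {x})"
proof -
  from assms obtain x y where xy: "x \<in> D" "y \<in> D'" "x \<rightarrow> y" "D - {x} = D' - {y}"
    by (auto simp: slide_gamma_graph_def)
  from xy(3) have "x \<noteq> y" using adj_not_same by blast
  with xy show thesis by (intro that[of x y]) auto
qed

text \<open>A further common element \<open>w\<close> would form a triangle with \<open>u\<close>
  and \<open>v\<close>.\<close>

lemma closed_neighborhood_Int_adj:
  assumes "\<And>u v w. u \<rightarrow> v \<Longrightarrow> v \<rightarrow> w \<Longrightarrow> \<not> u \<rightarrow> w"
    and "u \<rightarrow> v" "w \<in> closed_neighborhood G u" "w \<in> closed_neighborhood G v"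
  shows "w = u \<or> w = v"
  using assms by (auto simp: closed_neighborhood_iff)

section \<open>Common neighbours of two \<gamma>-sets\<close>

lemma common_slide_close:
  assumes A: "A = insert a S" "a \<notin> S" and B: "B = insert b S" "b \<notin> S" and "a \<noteq> b"
    and AC: "(A, C) \<in> parcs (slide_gamma_graph G)"
    and BC: "(B, C) \<in> parcs (slide_gamma_graph G)"
  shows "(\<exists>c. C = insert c S \<and> a \<rightarrow> c \<and> b \<rightarrow> c) \<or>
    (\<exists>s\<in>S. C = insert a (insert b (S - {s})) \<and> s \<rightarrow> a \<and> s \<rightarrow> b)"
proof -
  from AC obtain x y where xy: "x \<in> A" "y \<notin> A" "x \<rightarrow> y" "C = insert y (A - {x})" by (rule slideE)
  from BC obtain z w where zw: "z \<in> B" "w \<notin> B" "z \<rightarrow> w" "C = insert w (B - {z})" by (rule slideE)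
  show ?thesis
  \<comment> \<open>If \<open>a\<close> leaves \<open>A\<close>, then \<open>C\<close> contains
    \<open>S\<close>, so the slide from \<open>B\<close> must move \<open>b\<close> to the same
    vertex. Otherwise some \<open>s\<close> in \<open>S\<close> leaves \<open>A\<close>, and the
    same \<open>s\<close> leaves \<open>B\<close>.\<close>
  proof (cases "x = a")
    case True
    with xy A have C: "C = insert y S" by auto
    with zw B have "y \<noteq> b" by auto
    with C B \<open>b \<notin> S\<close> zw have "z = b" by auto
    with zw C B xy A have "w = y" by auto
    with C True \<open>z = b\<close> xy zw show ?thesis by blast
  next
    case False
    with A xy have "a \<in> C" "x \<in> S" by auto
    with zw A B \<open>a \<noteq> b\<close> have w: "w = a" by auto
    have "z \<noteq> b"
    proof
      assume "z = b"
      with zw w A B have "C = A" by auto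
      with xy show False by auto
    qed
    with zw B have "z \<in> S" "b \<in> C" by auto
    with xy A B \<open>a \<noteq> b\<close> have y: "y = b" by auto
    have "x = z"
    proof (rule ccontr)
      assume "x \<noteq> z"
      with \<open>x \<in> S\<close> zw B have "x \<in> C" by auto
      with xy show False by auto
    qed
    with y w xy zw \<open>x \<in> S\<close> A B \<open>a \<noteq> b\<close> show ?thesis by auto
  qed
qed

lemma common_slide_far:
  assumes AB: "A - B = {a, a'}" "a \<noteq> a'" and BA: "B - A = {b, b'}" "b \<noteq> b'"
    and AC: "(A, C) \<in> parcs (slide_gamma_graph G)"
    and BC: "(B, C) \<in> parcs (slide_gamma_graph G)"
  shows "\<exists>p q p' q'. {p, p'} = {a, a'} \<and> {q, q'} = {b, b'} \<and>
    C = insert p (insert q (A \<inter> B)) \<and> p' \<rightarrow> q \<and> q' \<rightarrow> p"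
proof -
  from AC obtain x y where xy: "x \<in> A" "y \<notin> A" "x \<rightarrow> y" "C = insert y (A - {x})" by (rule slideE)
  from BC obtain z w where zw: "z \<in> B" "w \<notin> B" "z \<rightarrow> w" "C = insert w (B - {z})" by (rule slideE)
  \<comment> \<open>A vertex of \<open>A - B\<close> other than \<open>x\<close> remains in
    \<open>C\<close>; being outside \<open>B\<close>, it can only be the arriving vertex
    \<open>w\<close>.\<close>
  have "A - B \<subseteq> {x, w}" using xy zw by blast
  with AB have xw: "{w, x} = {a, a'}" by auto
  have "B - A \<subseteq> {y, z}" using xy zw by blast
  with BA have yz: "{y, z} = {b, b'}" by auto
  have "w \<noteq> x" "y \<noteq> z" using xw yz AB BA by auto
  have "w \<in> A" "x \<notin> B" using xw AB by auto
  then have "C = insert w (insert y (A \<inter> B))"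
    using xy zw yz BA xw AB \<open>w \<noteq> x\<close> \<open>y \<noteq> z\<close> by blast
  with xw yz xy zw show ?thesis by blast
qed

section \<open>Excluding three common neighbours\<close>

theorem no_three_common_slides:
  assumes tf: "\<And>u v w. u \<rightarrow> v \<Longrightarrow> v \<rightarrow> w \<Longrightarrow> \<not> u \<rightarrow> w"
    and gam: "{D. gamma_set G D} = {A, B} \<union> T" and "A \<noteq> B" and cT: "card T = 3"
    and sA: "\<And>C. C \<in> T \<Longrightarrow> (A, C) \<in> parcs (slide_gamma_graph G)"
    and sB: "\<And>C. C \<in> T \<Longrightarrow> (B, C) \<in> parcs (slide_gamma_graph G)"
  shows False
proof -
  let ?N = "closed_neighborhood G"
  have tri: "w = u \<or> w = v" if "w \<in> ?N u" "w \<in> ?N v" "u \<rightarrow> v" for u v w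
    using closed_neighborhood_Int_adj tf that by blast
  have gA: "gamma_set G A" and gB: "gamma_set G B" and gT: "\<And>C. C \<in> T \<Longrightarrow> gamma_set G C"
    using gam by auto
  have fin: "finite A" "finite B" using gA gB gamma_set_finite by auto
  have cAB: "card A = card B" using gA gB by (rule gamma_set_card_eq)
  have dom: "\<exists>x\<in>D. v \<in> ?N x" if "gamma_set G D" "v \<in> verts G" for D v
    using that by (auto simp: gamma_set_def dominating_set_iff)
  have sub: "D \<subseteq> verts G" if "gamma_set G D" for D
    using that by (auto simp: gamma_set_def dominating_set_iff)
  from cT obtain C1 C2 C3 where T: "T = {C1, C2, C3}" "C1 \<noteq> C2" "C1 \<noteq> C3" "C2 \<noteq> C3"
    by (auto simp: card_3_iff)
  have diff: "card (A - B) = card (B - A)"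
    using fin cAB by (simp add: card_Diff_subset_Int Int_commute)
  have "card (A - B) \<noteq> 0"
  proof
    assume "card (A - B) = 0"
    with diff fin have "A - B = {}" "B - A = {}" by simp_all
    with \<open>A \<noteq> B\<close> show False by blast
  qed
  moreover have "card (A - B) \<le> 2"
  proof -
    obtain x y where "C1 = insert y (A - {x})" using sA[of C1] T slideE by blast
    moreover obtain z w where "C1 = insert w (B - {z})" using sB[of C1] T slideE by blast
    ultimately have "A - B \<subseteq> {x, w}" by blast
    then have "card (A - B) \<le> card {x, w}" by (intro card_mono) auto
    also have "\<dots> \<le> 2" by (simp add: card_insert_le_m1)
    finally show ?thesis .
  qed
  ultimately consider "card (A - B) = 1" | "card (A - B) = 2" by linarith
  then show False
  proof cases
    case 1
    then obtain a b where a: "A - B = {a}" and b: "B - A = {b}"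
      using diff by (metis card_1_singletonE)
    define S where "S = A \<inter> B"
    have A: "A = insert a S" "a \<notin> S" and B: "B = insert b S" "b \<notin> S" and "a \<noteq> b" and "finite S"
      using a b fin by (auto simp: S_def)
    define P where "P C \<longleftrightarrow> (\<exists>c. C = insert c S \<and> a \<rightarrow> c \<and> b \<rightarrow> c)" for C
    define Q where "Q C \<longleftrightarrow> (\<exists>s\<in>S. C = insert a (insert b (S - {s})) \<and> s \<rightarrow> a \<and> s \<rightarrow> b)" for C
    have PQ: "P C \<or> Q C" if "C \<in> T" for C
      unfolding P_def Q_def
      using common_slide_close[OF A B \<open>a \<noteq> b\<close> sA[OF that] sB[OF that]] .
    have "\<not> dominating_set G S"
      using gamma_set_card_le[OF gA, of S] A \<open>finite S\<close> by auto
    then obtain u where u: "u \<in> verts G" "\<And>x. x \<in> S \<Longrightarrow> u \<notin> ?N x"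
      using sub[OF gA] A by (auto simp: dominating_set_iff)
    have P_u: "C = insert u S" if C: "C \<in> T" "P C" for C
    proof -
      obtain c where c: "C = insert c S" "a \<rightarrow> c" "b \<rightarrow> c" using C by (auto simp: P_def)
      \<comment> \<open>Each of \<open>A\<close>, \<open>B\<close>, \<open>C\<close> dominates
        \<open>u\<close> only through the one vertex it adds to \<open>S\<close>. Hence
        \<open>u\<close> lies in \<open>{a, c}\<close> and in \<open>{b, c}\<close>.\<close>
      have "u \<in> ?N a" "u \<in> ?N b" "u \<in> ?N c"
        using dom[OF gA u(1)] dom[OF gB u(1)] dom[OF gT[OF C(1)] u(1)] u(2) A B c(1) by auto
      with tri[OF _ _ c(2)] tri[OF _ _ c(3)] \<open>a \<noteq> b\<close> have "u = c" by blast
      with c show ?thesis by simp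
    qed
    have Q_unique: "C = C'" if C: "C \<in> T" "Q C" and C': "C' \<in> T" "Q C'" for C C'
    proof (rule ccontr)
      assume "C \<noteq> C'"
      obtain s where s: "s \<in> S" "C = insert a (insert b (S - {s}))" "s \<rightarrow> a" "s \<rightarrow> b"
        using C by (auto simp: Q_def)
      obtain t where t: "t \<in> S" "C' = insert a (insert b (S - {t}))" "t \<rightarrow> a" "t \<rightarrow> b"
        using C' by (auto simp: Q_def)
      have "s \<noteq> t" using \<open>C \<noteq> C'\<close> s t by auto
      have "dominating_set G (insert a (S - {s}))"
        unfolding dominating_set_iff
      proof (intro conjI ballI)
        show "insert a (S - {s}) \<subseteq> verts G" using sub[OF gA] A by auto
      next
        fix v assume v: "v \<in> verts G"
        show "\<exists>x\<in>insert a (S - {s}). v \<in> ?N x"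
        proof (rule ccontr)
          assume no: "\<not> ?thesis"
          \<comment> \<open>\<open>A\<close> reaches \<open>v\<close> only through \<open>s\<close>,
            and \<open>C\<close> only through \<open>b\<close>, which are adjacent. But
            \<open>s\<close> is dominated by \<open>a\<close>, and \<open>b\<close> by
            \<open>t\<close>, which is kept since \<open>s \<noteq> t\<close>.\<close>
          have "v \<in> ?N s" using dom[OF gA v] no A by auto
          moreover have "v \<in> ?N b" using dom[OF gT[OF C(1)] v] no s(2) by auto
          ultimately have "v = s \<or> v = b" using tri[OF _ _ s(4)] by blast
          moreover have "s \<in> ?N a" using s(3) graph_symmetric by (simp add: closed_neighborhood_iff)
          moreover have "b \<in> ?N t" using t(4) by (simp add: closed_neighborhood_iff)
          ultimately show False using no t(1) \<open>s \<noteq> t\<close> by auto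
        qed
      qed
      then have "card A \<le> card (insert a (S - {s}))" by (rule gamma_set_card_le[OF gA])
      moreover have "card (insert a (S - {s})) = card S"
        using A(2) s(1) \<open>finite S\<close> by (auto simp: card_Suc_Diff1 simp del: card_Diff_insert card_Diff_singleton)
      ultimately show False using A \<open>finite S\<close> by simp
    qed
    have "C1 \<in> T" "C2 \<in> T" "C3 \<in> T" using T(1) by auto
    \<comment> \<open>Pigeonhole: three distinct sets, two kinds, at most one set of each
      kind.\<close>
    then show False using PQ P_u Q_unique T(2-4) by metis
  next
    case 2
    then obtain a a' b b' where a: "A - B = {a, a'}" "a \<noteq> a'" and b: "B - A = {b, b'}" "b \<noteq> b'"
      using diff by (metis card_2_iff)
    define S where "S = A \<inter> B"
    define M where "M p q = insert p (insert q S)" for p q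
    \<comment> \<open>The traces of \<open>M p q\<close> on \<open>A - B\<close> and
      \<open>B - A\<close> are \<open>{p}\<close> and \<open>{q}\<close>, so the set determines the
      pair.\<close>
    have M_eq: "M p q = M r t \<longleftrightarrow> p = r \<and> q = t"
      if "p \<in> A - B" "q \<in> B - A" "r \<in> A - B" "t \<in> B - A" for p q r t
    proof
      assume eq: "M p q = M r t"
      have "p \<in> M p q" "q \<in> M p q" by (auto simp: M_def)
      then have "p \<in> M r t" "q \<in> M r t" by (simp_all only: eq)
      with that show "p = r \<and> q = t" by (auto simp: M_def S_def)
    qed simp
    have form: "\<exists>p q p' q'. {p, p'} = {a, a'} \<and> {q, q'} = {b, b'} \<and> C = M p q \<and> p' \<rightarrow> q \<and> q' \<rightarrow> p"
      if "C \<in> T" for C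
      using common_slide_far[OF a b sA[OF that] sB[OF that]] unfolding M_def S_def .
    \<comment> \<open>By \<open>M_eq\<close>, the slides supplied by \<open>form\<close> are those
      of the given \<open>p\<close> and \<open>q\<close>, whose partners are then forced as
      well.\<close>
    have edges: "p' \<rightarrow> q \<and> q' \<rightarrow> p"
      if M: "M p q \<in> T" and pq: "{p, p'} = {a, a'}" "{q, q'} = {b, b'}" for p q p' q'
    proof -
      obtain r t r' t' where r: "{r, r'} = {a, a'}" "{t, t'} = {b, b'}" "M p q = M r t"
        "r' \<rightarrow> t" "t' \<rightarrow> r"
        using form[OF M] by blast
      have "p = r \<and> q = t" using M_eq[of p q r t] pq r a b by auto
      moreover have "r' = p' \<and> t' = q'" using calculation pq r(1,2) a(2) b(2) by (metis doubleton_eq_iff)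
      ultimately show ?thesis using r by auto
    qed
    have fourth: "M p' q' \<in> T"
      if p: "{p, p'} = {a, a'}" and q: "{q, q'} = {b, b'}"
        and T: "M p q \<in> T" "M p q' \<in> T" "M p' q \<in> T" for p p' q q'
    proof -
      have ne: "p \<noteq> p'" "q \<noteq> q'" using p q a(2) b(2) by auto
      have pp: "A - B = {p, p'}" and qq: "B - A = {q, q'}" using p q a(1) b(1) by simp_all
      have pA: "A = insert p (insert p' S)" "p \<notin> S" "p' \<notin> S"
        unfolding S_def using pp by blast+
      have qB: "B = insert q (insert q' S)" "q \<notin> S" "q' \<notin> S"
        unfolding S_def using qq by blast+
      have pq: "p \<in> A - B" "p' \<in> A - B" "q \<in> B - A" "q' \<in> B - A"
        unfolding pp qq by simp_all
      have q': "{q', q} = {b, b'}" using q by blast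
      \<comment> \<open>\<open>M p q\<close> gives the first two edges; \<open>M p q'\<close> gives
        the edge between \<open>q\<close> and \<open>p\<close>, to which \<open>tri\<close> is
        applied.\<close>
      have e: "p' \<rightarrow> q" "q' \<rightarrow> p" "q \<rightarrow> p"
        using edges[OF T(1) p q] edges[OF T(2) p q'] by simp_all
      have "dominating_set G (M p' q')"
        unfolding dominating_set_iff
      proof (intro conjI ballI)
        show "M p' q' \<subseteq> verts G" using sub[OF gA] sub[OF gB] pA qB by (auto simp: M_def)
      next
        fix v assume v: "v \<in> verts G"
        show "\<exists>x\<in>M p' q'. v \<in> ?N x"
        proof (rule ccontr)
          assume no: "\<not> ?thesis"
          \<comment> \<open>\<open>M p' q'\<close> contains \<open>A\<close> without
            \<open>p\<close> and \<open>B\<close> without \<open>q\<close>, so only \<open>p\<close>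
            and \<open>q\<close> can reach \<open>v\<close> from \<open>A\<close> and
            \<open>B\<close>. Then \<open>v\<close> is one of them, yet \<open>q'\<close> dominates
            \<open>p\<close> and \<open>p'\<close> dominates \<open>q\<close>.\<close>
          have "v \<in> ?N p" using dom[OF gA v] no pA(1) by (auto simp: M_def)
          moreover have "v \<in> ?N q" using dom[OF gB v] no qB(1) by (auto simp: M_def)
          ultimately have "v = q \<or> v = p" using tri[OF _ _ e(3)] by blast
          moreover have "p \<in> ?N q'" "q \<in> ?N p'" using e by (auto simp: closed_neighborhood_iff)
          ultimately show False using no by (auto simp: M_def)
        qed
      qed
      moreover have "card (M p' q') = card A"
      proof -
        have "finite S" using fin by (simp add: S_def)
        moreover have "p' \<noteq> q'" using pq by auto
        ultimately show ?thesis
          unfolding M_def by (subst pA(1)) (simp add: ne pA(2,3) qB(2,3))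
      qed
      ultimately have "gamma_set G (M p' q')" by (rule gamma_setI[OF gA])
      moreover have "M p' q' \<noteq> A" "M p' q' \<noteq> B" using pq by (auto simp: M_def)
      ultimately show ?thesis using gam by blast
    qed
    have ab: "a \<in> A - B" "a' \<in> A - B" "b \<in> B - A" "b' \<in> B - A" using a(1) b(1) by auto
    let ?F = "{M a b, M a b', M a' b, M a' b'}"
    have F: "card ?F = 4" using a(2) b(2) ab by (simp add: M_eq)
    have "T \<subseteq> ?F"
    proof
      fix C assume "C \<in> T"
      then obtain p q p' q' where "{p, p'} = {a, a'}" "{q, q'} = {b, b'}" and C: "C = M p q"
        using form by blast
      then have "p \<in> {a, a'}" "q \<in> {b, b'}" by blast+
      with C show "C \<in> ?F" by auto
    qed
    moreover from this have "finite T" by (rule finite_subset) simp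
    \<comment> \<open>Exactly one of the four candidates is missing from \<open>T\<close>;
      \<open>step\<close> shows that it can be none of them, since the other three would force it
      into \<open>T\<close>.\<close>
    ultimately have "card (?F - T) = 1" using F cT by (simp only: card_Diff_subset)
    then obtain D where "?F - T = {D}" by (rule card_1_singletonE)
    then have D: "D \<in> ?F" "D \<notin> T" "\<And>E. E \<in> ?F \<Longrightarrow> E \<noteq> D \<Longrightarrow> E \<in> T" by blast+
    have step: "D \<noteq> M p q" if p: "{p', p} = {a, a'}" and q: "{q', q} = {b, b'}" for p q p' q'
    proof
      assume "D = M p q"
      have ne: "p' \<noteq> p" "q' \<noteq> q" using p q a(2) b(2) by auto
      have "p \<in> A - B" "p' \<in> A - B" "q \<in> B - A" "q' \<in> B - A"
        using p q a(1) b(1) by auto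
      with ne \<open>D = M p q\<close> have "M p' q' \<noteq> D" "M p' q \<noteq> D" "M p q' \<noteq> D"
        by (simp_all only: M_eq) auto
      moreover have "p \<in> {a, a'}" "p' \<in> {a, a'}" "q \<in> {b, b'}" "q' \<in> {b, b'}"
        using p q by blast+
      then have "M p' q' \<in> ?F" "M p' q \<in> ?F" "M p q' \<in> ?F" by blast+
      ultimately have "M p' q' \<in> T" "M p' q \<in> T" "M p q' \<in> T" using D(3) by blast+
      with fourth[OF p q] \<open>D = M p q\<close> D(2) show False by blast
    qed
    show False
      using D(1) step[of a' a b' b] step[of a' a b b'] step[of a a' b' b] step[of a a' b b']
      by (simp add: insert_commute)
  qed
qed

end

lemma bipartite_triangle_free:
  assumes "bipartite G" "u \<rightarrow>\<^bsub>G\<^esub> v" "v \<rightarrow>\<^bsub>G\<^esub> w"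
  shows "\<not> u \<rightarrow>\<^bsub>G\<^esub> w"
  using assms unfolding bipartite_def by blast

text \<open>The two sides are pulled back along the vertex map of the isomorphism, whose injectivity
  preserves their sizes and lifts arcs of \<open>K\<close> to arcs of \<open>H\<close>.\<close>

lemma digraph_iso_complete_bipartiteE:
  assumes "digraph_iso H K" "K\<^bsub>m,n\<^esub> K"
  obtains U V where "verts H = U \<union> V" "U \<inter> V = {}" "card U = m" "card V = n"
    "U \<times> V \<union> V \<times> U \<subseteq> arcs_ends H"
proof -
  from assms(1) obtain f where f: "pre_digraph.digraph_isomorphism H f" and K: "K = app_iso f H"
    by (auto simp: digraph_iso_def)
  let ?h = "iso_verts f"
  have wf: "wf_digraph H" and inj: "inj_on ?h (verts H)"
    using f by (auto simp: pre_digraph.digraph_isomorphism_def)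
  from assms(2) obtain U V where UV: "verts K = U \<union> V" "U \<inter> V = {}" "card U = m" "card V = n"
    "arcs_ends K = U \<times> V \<union> V \<times> U"
    by (auto simp: complete_bipartite_digraph_def)
  have img: "?h ` verts H = U \<union> V" using UV(1) K by simp
  have ends: "(x, y) \<in> arcs_ends H"
    if "x \<in> verts H" "y \<in> verts H" "(?h x, ?h y) \<in> arcs_ends K" for x y
  proof -
    from that(3) obtain e where e: "e \<in> arcs H"
      "?h x = iso_tail f (iso_arcs f e)" "?h y = iso_head f (iso_arcs f e)"
      by (auto simp: K arcs_ends_conv)
    then have "?h x = ?h (tail H e)" "?h y = ?h (head H e)"
      using f by (auto simp: pre_digraph.digraph_isomorphism_def)
    moreover have "tail H e \<in> verts H" "head H e \<in> verts H"
      using wf e(1) by (auto simp: wf_digraph_def)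
    ultimately have "x = tail H e" "y = head H e"
      using inj that(1,2) by (auto dest: inj_onD)
    then show ?thesis using e(1) by (auto simp: arcs_ends_conv)
  qed
  have card: "card (?h -` W \<inter> verts H) = card W" if "W \<subseteq> U \<union> V" for W
  proof -
    have "?h ` (?h -` W \<inter> verts H) = W \<inter> ?h ` verts H" by blast
    also have "\<dots> = W" using that img by blast
    finally have "?h ` (?h -` W \<inter> verts H) = W" .
    then show ?thesis using inj by (metis card_image inf_le2 inj_on_subset)
  qed
  show thesis
  proof (rule that[of "?h -` U \<inter> verts H" "?h -` V \<inter> verts H"])
    show "verts H = ?h -` U \<inter> verts H \<union> ?h -` V \<inter> verts H" using img by blast
    show "?h -` U \<inter> verts H \<inter> (?h -` V \<inter> verts H) = {}" using UV(2) by blast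
    show "card (?h -` U \<inter> verts H) = m" "card (?h -` V \<inter> verts H) = n" using card UV by auto
  qed (use ends UV(5) in blast)
qed

theorem theorem6:
  fixes K :: "('v, 'e) pre_digraph"
  assumes "K\<^bsub>2,3\<^esub> K"
  shows "\<not> (\<exists>G :: ('a, 'b) pre_digraph.
    graph G \<and> bipartite G \<and> digraph_iso (with_proj (slide_gamma_graph G)) K)"
proof
  assume "\<exists>G :: ('a, 'b) pre_digraph.
    graph G \<and> bipartite G \<and> digraph_iso (with_proj (slide_gamma_graph G)) K"
  then obtain G :: "('a, 'b) pre_digraph" where G: "graph G" "bipartite G"
    and iso: "digraph_iso (with_proj (slide_gamma_graph G)) K"
    by blast
  obtain U T where UT: "pverts (slide_gamma_graph G) = U \<union> T" "card U = 2" "card T = 3"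
    "U \<times> T \<subseteq> parcs (slide_gamma_graph G)"
    by (rule digraph_iso_complete_bipartiteE[OF iso assms]) simp
  obtain A B where AB: "U = {A, B}" "A \<noteq> B" using UT(2) by (auto simp: card_2_iff)
  show False
  proof (rule graph.no_three_common_slides[OF G(1) _ _ AB(2) UT(3)])
    show "{D. gamma_set G D} = {A, B} \<union> T" using UT(1) AB(1) by (simp add: slide_gamma_graph_def)
  qed (use UT(4) AB(1) bipartite_triangle_free[OF G(2)] in auto)
qed

end
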